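(* Let $\mathcal{H}_1\to\mathcal{H}_2$ be a central morphism of affine Hecke algebras. For $g\in X_2/X_1$ let $\mathcal{H}_{2,g}$ be the linear span in $\mathcal{H}_2$ of $\{\theta_xT_w: x\in X_2,\ x+X_1=g,\ w\in W\}$. Then the subspaces $\mathcal{H}_{2,g}$ give an $X_2/X_1$-grading on the algebra $\mathcal{H}_2$ (that is, $\mathcal{H}_2=\bigoplus_{g\in X_2/X_1}\mathcal{H}_{2,g}$ and $\mathcal{H}_{2,g}\mathcal{H}_{2,g'}\subset\mathcal{H}_{2,g+g'}$ for all $g,g'\in X_2/X_1$), and $\mathcal{H}_{2,0}=\mathcal{H}_1$.
   Context: Affine Hecke algebras. Let $\mathcal{R} = (X,R,Y,R^\vee,\Delta)$ be a reduced based root datum ($X,Y$ free abelian of finite rank in perfect duality $\langle\cdot,\cdot\rangle$, $\Delta\subset R$ a base of simple roots), with finite Weyl group $W$ and simple reflections $s_\alpha$, $\alpha\in\Delta$. Fix $q\in\mathbb{R}_{>1}$ and parameter functions $\lambda,\lambda^*: R\to\mathbb{R}\setminus\{0\}$, constant on orbits of $W\ltimes X$ (acting on $R$ through $W$), with $\lambda(\alpha)=\lambda^*(\alpha)$ if $\alpha^\vee\notin 2Y$ and $\lambda(\alpha)+\lambda^*(\alpha)\neq 0$ if $\alpha^\vee\in 2Y$. The affine Hecke algebra $\mathcal{H}=\mathcal{H}(\mathcal{R})$ is the $\mathbb{C}$-algebra with linear basis $\theta_xT_w$ ($x\in X$, $w\in W$) and relations: $T_wT_{w'}=T_{ww'}$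 if $\ell(ww')=\ell(w)+\ell(w')$; $(T_{s_\alpha}+1)(T_{s_\alpha}-q^{\lambda(\alpha)})=0$ for $\alpha\in\Delta$; $\theta_x\theta_y=\theta_{x+y}$; and, for $s=s_\alpha$, $\alpha\in\Delta$, $T_s\theta_x=\theta_{s(x)}T_s+(q^{\lambda(\alpha)}-1)\frac{\theta_x-\theta_{s(x)}}{1-\theta_{-\alpha}}$ if $\alpha^\vee\notin 2Y$, and $T_s\theta_x=\theta_{s(x)}T_s+\big((q^{\lambda(\alpha)}-1)+\theta_{-\alpha}(q^{(\lambda(\alpha)+\lambda^*(\alpha))/2}-q^{(\lambda(\alpha)-\lambda^*(\alpha))/2})\big)\frac{\theta_x-\theta_{s(x)}}{1-\theta_{-2\alpha}}$ if $\alpha^\vee\in 2Y$. Central morphisms. A central morphism of based root data $(X_1,R_1,Y_1,R_1^\vee,\Delta_1)\to(X_2,R_2,Y_2,R_2^\vee,\Delta_2)$ is a group homomorphism $f:X_1\to X_2$ (not required to be injective) whose restriction to $R_1$ defines an isomorphism of based root systems $(\mathbb{R}R_1,R_1,\mathbb{R}R_1^\vee,R_1^\vee,\Delta_1)\to(\mathbb{R}R_2,R_2,\mathbb{R}R_2^\vee,R_2^\vee,\Delta_2)$, where the transpose $f^\vee:Y_2\to Y_1$ sends $f(\alpha)^\vee$ to $\alpha^\vee$ for all $\alpha\in R_1$ (so the Weyl groups are identified, both denoted $W$, and $f$ is $W$-equivariant). If the parameters are compatible (same $q$, $\lambda_2\circ f=\lambda_1$ and $\lambda_2^*\circ f=\lambda_1^*$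 on $R_1$), there is an algebra homomorphism $\mathcal{H}_1=\mathcal{H}(\mathcal{R}_1)\to\mathcal{H}_2=\mathcal{H}(\mathcal{R}_2)$, $\theta_xT_w\mapsto\theta_{f(x)}T_w$, called a central morphism of affine Hecke algebras; if $f$ is injective this is an inclusion. Write $X_2/X_1$ for the cokernel $X_2/f(X_1)$, and $x+X_1$ for the class of $x\in X_2$ in it. *)

theory Defs
  imports Complex_Main "HOL-Library.Set_Algebras"
begin

section \<open>Free abelian groups of finite rank\<close>

definition zsc :: "int \<Rightarrow> 'a::ab_group_add \<Rightarrow> 'a" where
  "zsc n x = (\<Sum>i<nat n. x) - (\<Sum>i<nat (- n). x)"

lemma zsc_of_nat: "zsc (int n) x = (\<Sum>i<n. x)"
  by (simp add: zsc_def)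

lemma zsc_0 [simp]: "zsc 0 x = 0" and zsc_1 [simp]: "zsc 1 x = x"
  by (simp_all add: zsc_def)

lemma zsc_minus: "zsc (- n) x = - zsc n x"
  by (simp add: zsc_def)

lemma zsc_Suc: "zsc (n + 1) x = zsc n x + x"
proof (cases "n \<ge> 0")
  case True
  then have "nat (n + 1) = Suc (nat n)" "nat (- (n + 1)) = 0" "nat (- n) = 0" by auto
  then show ?thesis by (simp add: zsc_def)
next
  case False
  then have "nat (- n) = Suc (nat (- (n + 1)))" "nat (n + 1) = 0" "nat n = 0" by auto
  then show ?thesis by (simp only: zsc_def) simp
qed

lemma zsc_add_left: "zsc (m + n) x = zsc m x + zsc n x"
proof (induction n rule: int_induct[where k = 0])
  case (step1 i)
  then show ?case using zsc_Suc[of "m + i" x] zsc_Suc[of i x] by (simp add: add.assoc)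
next
  case (step2 i)
  then show ?case using zsc_Suc[of "m + (i - 1)" x] zsc_Suc[of "i - 1" x]
    by (simp add: algebra_simps)
qed simp

lemma zsc_add_right: "zsc n (x + y) = zsc n x + zsc n y"
  by (simp add: zsc_def sum.distrib)

lemma zsc_zsc: "zsc m (zsc n x) = zsc (m * n) x"
proof (induction m rule: int_induct[where k = 0])
  case (step1 i)
  then show ?case by (simp add: zsc_Suc distrib_right zsc_add_left)
next
  case (step2 i)
  have "zsc i (zsc n x) = zsc (i - 1) (zsc n x) + zsc n x"
    using zsc_Suc[of "i - 1" "zsc n x"] by simp
  moreover have "zsc (i * n) x = zsc ((i - 1) * n) x + zsc n x"
    using zsc_add_left[of "(i - 1) * n" n x] by (simp add: algebra_simps)
  ultimately show ?case using step2 by simp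
qed simp

interpretation zmod: module zsc
  by unfold_locales (simp_all add: zsc_add_right zsc_add_left zsc_zsc)

definition free_finite_rank :: "'a::ab_group_add itself \<Rightarrow> bool" where
  "free_finite_rank _ \<longleftrightarrow>
     (\<exists>B :: 'a set. finite B \<and> \<not> zmod.dependent B \<and> zmod.span B = UNIV)"

definition perfect_pairing :: "('x::ab_group_add \<Rightarrow> 'y::ab_group_add \<Rightarrow> int) \<Rightarrow> bool" where
  "perfect_pairing p \<longleftrightarrow>
     (\<forall>x. additive (p x)) \<and> (\<forall>y. additive (\<lambda>x. p x y)) \<and>
     (\<forall>h. additive h \<longrightarrow> (\<exists>!x. \<forall>y. p x y = h y)) \<and>
     (\<forall>h. additive h \<longrightarrow> (\<exists>!y. \<forall>x. p x y = h x))"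


section \<open>Based root data\<close>

text \<open>The lattices \<open>X\<close> and \<open>Y\<close> are the whole types \<open>'x\<close> and \<open>'y\<close>.  The set \<open>R\<^sup>\<or>\<close> is the image of the
  roots under the map \<open>\<alpha> \<mapsto> \<alpha>\<^sup>\<or>\<close>.\<close>

record ('x, 'y) root_datum =
  pairing :: "'x \<Rightarrow> 'y \<Rightarrow> int"
  roots :: "'x set"
  coroot :: "'x \<Rightarrow> 'y"
  simple :: "'x set"

definition coroots :: "('x, 'y) root_datum \<Rightarrow> 'y set" where
  "coroots D = coroot D ` roots D"

definition reflection ::
    "('x::ab_group_add, 'y::ab_group_add) root_datum \<Rightarrow> 'x \<Rightarrow> 'x \<Rightarrow> 'x" where
  "reflection D \<alpha> x = x - zsc (pairing D x (coroot D \<alpha>)) \<alpha>"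

definition coreflection ::
    "('x::ab_group_add, 'y::ab_group_add) root_datum \<Rightarrow> 'x \<Rightarrow> 'y \<Rightarrow> 'y" where
  "coreflection D \<alpha> y = y - zsc (pairing D \<alpha> y) (coroot D \<alpha>)"

locale reduced_based_root_datum =
  fixes D :: "('x::ab_group_add, 'y::ab_group_add) root_datum"
  assumes free_X: "free_finite_rank TYPE('x)"
    and free_Y: "free_finite_rank TYPE('y)"
    and perfect: "perfect_pairing (pairing D)"
    and finite_roots: "finite (roots D)"
    and coroot_inj: "inj_on (coroot D) (roots D)"
    and pairing_coroot: "\<alpha> \<in> roots D \<Longrightarrow> pairing D \<alpha> (coroot D \<alpha>) = 2"
    and reflection_roots: "\<alpha> \<in> roots D \<Longrightarrow> reflection D \<alpha> ` roots D = roots D"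
    and coreflection_coroots: "\<alpha> \<in> roots D \<Longrightarrow> coreflection D \<alpha> ` coroots D = coroots D"
    and reduced: "\<lbrakk>\<alpha> \<in> roots D; \<beta> \<in> roots D; n \<noteq> 0; zsc n \<beta> = zsc m \<alpha>\<rbrakk> \<Longrightarrow> \<beta> = \<alpha> \<or> \<beta> = - \<alpha>"
    and simple_roots: "simple D \<subseteq> roots D"
    and simple_independent: "\<not> zmod.dependent (simple D)"
    and simple_base: "\<beta> \<in> roots D \<Longrightarrow> \<exists>c :: 'x \<Rightarrow> int. \<beta> = (\<Sum>\<alpha>\<in>simple D. zsc (c \<alpha>) \<alpha>) \<and>
           ((\<forall>\<alpha>\<in>simple D. c \<alpha> \<ge> 0) \<or> (\<forall>\<alpha>\<in>simple D. c \<alpha> \<le> 0))"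

text \<open>The Weyl group, as a group of automorphisms of \<open>X\<close>.  Reflections are involutions, so the
  monoid they generate is the group they generate.\<close>

inductive_set weyl :: "('x::ab_group_add, 'y::ab_group_add) root_datum \<Rightarrow> ('x \<Rightarrow> 'x) set"
  for D where
    weyl_id: "id \<in> weyl D"
  | weyl_step: "\<lbrakk>\<alpha> \<in> roots D; w \<in> weyl D\<rbrakk> \<Longrightarrow> reflection D \<alpha> \<circ> w \<in> weyl D"

definition weyl_length ::
    "('x::ab_group_add, 'y::ab_group_add) root_datum \<Rightarrow> ('x \<Rightarrow> 'x) \<Rightarrow> nat" where
  "weyl_length D w = (LEAST n. \<exists>as. length as = n \<and> set as \<subseteq> simple D \<and>
                        w = foldr (\<circ>) (map (reflection D) as) id)"


section \<open>Affine Hecke algebras\<close>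

text \<open>\<open>\<alpha>\<^sup>\<or> \<in> 2Y\<close>\<close>

definition coroot_even :: "('x, 'y::ab_group_add) root_datum \<Rightarrow> 'x \<Rightarrow> bool" where
  "coroot_even D \<alpha> \<longleftrightarrow> (\<exists>y. coroot D \<alpha> = y + y)"

text \<open>\<open>X\<close> acts trivially on the roots, so being constant on the orbits of \<open>W \<ltimes> X\<close> is being
  constant on the orbits of \<open>W\<close>.\<close>

definition hecke_parameters ::
    "('x::ab_group_add, 'y::ab_group_add) root_datum \<Rightarrow> real \<Rightarrow> ('x \<Rightarrow> real) \<Rightarrow> ('x \<Rightarrow> real) \<Rightarrow> bool"
  where
  "hecke_parameters D q lam lams \<longleftrightarrow> q > 1 \<and>
     (\<forall>\<alpha>\<in>roots D. lam \<alpha> \<noteq> 0 \<and> lams \<alpha> \<noteq> 0 \<and>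
        (\<forall>w\<in>weyl D. lam (w \<alpha>) = lam \<alpha> \<and> lams (w \<alpha>) = lams \<alpha>) \<and>
        (if coroot_even D \<alpha> then lam \<alpha> + lams \<alpha> \<noteq> 0 else lam \<alpha> = lams \<alpha>))"

text \<open>The library has no class of complex algebras: a complex algebra is a unital ring together
  with a scalar multiplication.\<close>

locale complex_algebra = vector_space scale
  for scale :: "complex \<Rightarrow> 'h::ring_1 \<Rightarrow> 'h" +
  assumes scale_mult_left: "scale c a * b = scale c (a * b)"
    and scale_mult_right: "a * scale c b = scale c (a * b)"

text \<open>The fraction \<open>a / b\<close> in the linear span of the \<open>\<theta>\<^sub>x\<close>, which is the group algebra of \<open>X\<close> and
  hence an integral domain.\<close>

definition theta_fraction ::
    "(complex \<Rightarrow> 'h::ring_1 \<Rightarrow> 'h) \<Rightarrow> ('x \<Rightarrow> 'h) \<Rightarrow> 'h \<Rightarrow> 'h \<Rightarrow> 'h" where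
  "theta_fraction scale \<theta> a b = (THE d. d \<in> module.span scale (range \<theta>) \<and> d * b = a)"

text \<open>The values of \<open>T\<close> outside the Weyl group are irrelevant.\<close>

locale affine_hecke_algebra =
  reduced_based_root_datum D + complex_algebra scale
  for D :: "('x::ab_group_add, 'y::ab_group_add) root_datum"
    and q :: real
    and lam lams :: "'x \<Rightarrow> real"
    and scale :: "complex \<Rightarrow> 'h::ring_1 \<Rightarrow> 'h"
    and \<theta> :: "'x \<Rightarrow> 'h"
    and T :: "('x \<Rightarrow> 'x) \<Rightarrow> 'h" +
  assumes parameters: "hecke_parameters D q lam lams"
    and basis_distinct: "inj_on (\<lambda>(x, w). \<theta> x * T w) (UNIV \<times> weyl D)"
    and basis_independent: "\<not> module.dependent scale {\<theta> x * T w | x w. w \<in> weyl D}"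
    and basis_span: "module.span scale {\<theta> x * T w | x w. w \<in> weyl D} = UNIV"
    and T_mult: "\<lbrakk>w \<in> weyl D; w' \<in> weyl D;
           weyl_length D (w \<circ> w') = weyl_length D w + weyl_length D w'\<rbrakk>
         \<Longrightarrow> T w * T w' = T (w \<circ> w')"
    and T_quadratic: "\<alpha> \<in> simple D \<Longrightarrow>
           (T (reflection D \<alpha>) + 1) * (T (reflection D \<alpha>) - scale (of_real (q powr lam \<alpha>)) 1) = 0"
    and theta_mult: "\<theta> x * \<theta> y = \<theta> (x + y)"
    and bernstein_odd: "\<lbrakk>\<alpha> \<in> simple D; \<not> coroot_even D \<alpha>\<rbrakk> \<Longrightarrow>
           T (reflection D \<alpha>) * \<theta> x =
             \<theta> (reflection D \<alpha> x) * T (reflection D \<alpha>)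
             + scale (of_real (q powr lam \<alpha> - 1))
                 (theta_fraction scale \<theta> (\<theta> x - \<theta> (reflection D \<alpha> x)) (1 - \<theta> (- \<alpha>)))"
    and bernstein_even: "\<lbrakk>\<alpha> \<in> simple D; coroot_even D \<alpha>\<rbrakk> \<Longrightarrow>
           T (reflection D \<alpha>) * \<theta> x =
             \<theta> (reflection D \<alpha> x) * T (reflection D \<alpha>)
             + (scale (of_real (q powr lam \<alpha> - 1)) 1
                + scale (of_real (q powr ((lam \<alpha> + lams \<alpha>) / 2) - q powr ((lam \<alpha> - lams \<alpha>) / 2)))
                    (\<theta> (- \<alpha>)))
               * theta_fraction scale \<theta> (\<theta> x - \<theta> (reflection D \<alpha> x)) (1 - \<theta> (- (\<alpha> + \<alpha>)))"


section \<open>Central morphisms\<close>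

definition transpose ::
    "('x1, 'y1) root_datum \<Rightarrow> ('x2, 'y2) root_datum \<Rightarrow> ('x1 \<Rightarrow> 'x2) \<Rightarrow> 'y2 \<Rightarrow> 'y1" where
  "transpose D1 D2 f y = (THE y'. \<forall>x. pairing D2 (f x) y = pairing D1 x y')"

text \<open>The linear isomorphisms of \<open>\<real>R\<^sub>1\<close> with \<open>\<real>R\<^sub>2\<close> and of \<open>\<real>R\<^sub>2\<^sup>\<or>\<close> with \<open>\<real>R\<^sub>1\<^sup>\<or>\<close> are stated on the
  lattices spanned by the roots and coroots, from which they arise by extension of scalars.\<close>

definition central_root_datum_morphism ::
    "('x1::ab_group_add, 'y1::ab_group_add) root_datum \<Rightarrow>
     ('x2::ab_group_add, 'y2::ab_group_add) root_datum \<Rightarrow> ('x1 \<Rightarrow> 'x2) \<Rightarrow> bool" where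
  "central_root_datum_morphism D1 D2 f \<longleftrightarrow>
     additive f \<and>
     bij_betw f (zmod.span (roots D1)) (zmod.span (roots D2)) \<and>
     bij_betw f (roots D1) (roots D2) \<and>
     bij_betw f (simple D1) (simple D2) \<and>
     bij_betw (transpose D1 D2 f) (zmod.span (coroots D2)) (zmod.span (coroots D1)) \<and>
     (\<forall>\<alpha>\<in>roots D1. transpose D1 D2 f (coroot D2 (f \<alpha>)) = coroot D1 \<alpha>)"

text \<open>The graph of the isomorphism of Weyl groups with \<open>s\<^sub>\<alpha> \<mapsto> s\<^bsub>f \<alpha>\<^esub>\<close>.\<close>

inductive_set weyl_identification ::
    "('x1::ab_group_add, 'y1::ab_group_add) root_datum \<Rightarrow>
     ('x2::ab_group_add, 'y2::ab_group_add) root_datum \<Rightarrow> ('x1 \<Rightarrow> 'x2) \<Rightarrow>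
     (('x1 \<Rightarrow> 'x1) \<times> ('x2 \<Rightarrow> 'x2)) set"
  for D1 D2 f where
    ident_id: "(id, id) \<in> weyl_identification D1 D2 f"
  | ident_step: "\<lbrakk>\<alpha> \<in> roots D1; (w, w') \<in> weyl_identification D1 D2 f\<rbrakk>
      \<Longrightarrow> (reflection D1 \<alpha> \<circ> w, reflection D2 (f \<alpha>) \<circ> w') \<in> weyl_identification D1 D2 f"

definition algebra_hom ::
    "(complex \<Rightarrow> 'h1::ring_1 \<Rightarrow> 'h1) \<Rightarrow> (complex \<Rightarrow> 'h2::ring_1 \<Rightarrow> 'h2) \<Rightarrow> ('h1 \<Rightarrow> 'h2) \<Rightarrow> bool" where
  "algebra_hom scale1 scale2 \<phi> \<longleftrightarrow>
     Vector_Spaces.linear scale1 scale2 \<phi> \<and> \<phi> 1 = 1 \<and> (\<forall>a b. \<phi> (a * b) = \<phi> a * \<phi> b)"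

locale central_hecke_morphism =
  H1: affine_hecke_algebra D1 q lam1 lams1 scale1 \<theta>1 T1 +
  H2: affine_hecke_algebra D2 q lam2 lams2 scale2 \<theta>2 T2
  for q :: real
    and D1 :: "('x1::ab_group_add, 'y1::ab_group_add) root_datum"
    and lam1 lams1 :: "'x1 \<Rightarrow> real"
    and scale1 :: "complex \<Rightarrow> 'h1::ring_1 \<Rightarrow> 'h1"
    and \<theta>1 :: "'x1 \<Rightarrow> 'h1"
    and T1 :: "('x1 \<Rightarrow> 'x1) \<Rightarrow> 'h1"
    and D2 :: "('x2::ab_group_add, 'y2::ab_group_add) root_datum"
    and lam2 lams2 :: "'x2 \<Rightarrow> real"
    and scale2 :: "complex \<Rightarrow> 'h2::ring_1 \<Rightarrow> 'h2"
    and \<theta>2 :: "'x2 \<Rightarrow> 'h2"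
    and T2 :: "('x2 \<Rightarrow> 'x2) \<Rightarrow> 'h2" +
  fixes f :: "'x1 \<Rightarrow> 'x2"
    and \<phi> :: "'h1 \<Rightarrow> 'h2"
  assumes root_datum_morphism: "central_root_datum_morphism D1 D2 f"
    and compatible: "\<alpha> \<in> roots D1 \<Longrightarrow> lam2 (f \<alpha>) = lam1 \<alpha> \<and> lams2 (f \<alpha>) = lams1 \<alpha>"
    and hom: "algebra_hom scale1 scale2 \<phi>"
    and hom_basis: "(w, w') \<in> weyl_identification D1 D2 f
           \<Longrightarrow> \<phi> (\<theta>1 x * T1 w) = \<theta>2 (f x) * T2 w'"


section \<open>Gradings\<close>

text \<open>The elements of the cokernel are the cosets of the image, added as sets; its zero element is
  \<open>range f\<close>.\<close>

definition cokernel :: "('x1 \<Rightarrow> 'x2::ab_group_add) \<Rightarrow> 'x2 set set" where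
  "cokernel f = {x +o range f | x. True}"

text \<open>A grading of an algebra by a group with carrier \<open>G\<close> whose addition is that of its type.\<close>

definition graded_algebra ::
    "(complex \<Rightarrow> 'h::ring_1 \<Rightarrow> 'h) \<Rightarrow> ('g::plus) set \<Rightarrow> ('g \<Rightarrow> 'h set) \<Rightarrow> bool" where
  "graded_algebra scale G A \<longleftrightarrow>
     (\<forall>g\<in>G. module.subspace scale (A g)) \<and>
     (\<forall>h. \<exists>!c. finite {g. c g \<noteq> 0} \<and> {g. c g \<noteq> 0} \<subseteq> G \<and> (\<forall>g\<in>G. c g \<in> A g) \<and>
               h = (\<Sum>g\<in>{g. c g \<noteq> 0}. c g)) \<and>
     (\<forall>g\<in>G. \<forall>g'\<in>G. \<forall>a\<in>A g. \<forall>b\<in>A g'. a * b \<in> A (g + g'))"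

definition hecke_component ::
    "('x1 \<Rightarrow> 'x2) \<Rightarrow> ('x2::ab_group_add, 'y2::ab_group_add) root_datum \<Rightarrow>
     (complex \<Rightarrow> 'h2::ring_1 \<Rightarrow> 'h2) \<Rightarrow> ('x2 \<Rightarrow> 'h2) \<Rightarrow> (('x2 \<Rightarrow> 'x2) \<Rightarrow> 'h2) \<Rightarrow> 'x2 set \<Rightarrow> 'h2 set" where
  "hecke_component f D scale \<theta> T g =
     module.span scale {\<theta> x * T w | x w. x +o range f = g \<and> w \<in> weyl D}"

end

theory Submission
  imports Defs
begin

text \<open>The basis elements \<open>\<theta>\<^sub>x T\<^sub>w\<close> are sorted by the class of \<open>x\<close>, so only the inclusion of products
  needs an argument, and it reduces to showing that \<open>T\<^sub>w\<close> preserves each component.  Since \<open>T\<^sub>w\<close> is a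
  product of elements \<open>T\<^sub>s\<close> with \<open>s = s\<^sub>\<alpha>\<close> simple, this follows from the Bernstein relation: its
  fraction telescopes into a sum of \<open>\<theta>\<^bsub>x - k\<alpha>\<^esub>\<close>, and \<open>\<alpha>\<close> lies in the image of \<open>f\<close>.  It is also used
  that \<open>T\<^sub>s T\<^sub>w\<close> stays in the span of the \<open>T\<^sub>v\<close>, which needs the lengths of \<open>w\<close> and \<open>s w\<close> to differ by
  exactly one.\<close>

section \<open>Reflections and the Weyl group\<close>

lemma additive_zsc:
  assumes "additive h"
  shows "h (zsc n x) = zsc n (h x)"
proof -
  have s: "h (\<Sum>i<m. x) = (\<Sum>i<m. h x)" for m :: nat
    by (induction m) (simp_all add: additive.zero[OF assms] additive.add[OF assms])
  show ?thesis
    by (simp add: zsc_def additive.diff[OF assms] s del: sum_constant)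
qed

lemma zsc_int: "zsc n (k :: int) = n * k"
  by (simp add: zsc_def algebra_simps)

section \<open>Reflections and an invariant form on the weight lattice\<close>

context reduced_based_root_datum
begin

lemma additive_pairing_right: "additive (pairing D x)"
  using perfect by (simp add: perfect_pairing_def)

lemma additive_pairing_left: "additive (\<lambda>x. pairing D x y)"
  using perfect by (simp add: perfect_pairing_def)

lemmas pairing_linear =
  additive.add[OF additive_pairing_right] additive.diff[OF additive_pairing_right]
  additive.minus[OF additive_pairing_right] additive.zero[OF additive_pairing_right]
  additive.add[OF additive_pairing_left] additive.diff[OF additive_pairing_left]
  additive.minus[OF additive_pairing_left] additive.zero[OF additive_pairing_left]
  additive_zsc[OF additive_pairing_right, unfolded zsc_int]
  additive_zsc[OF additive_pairing_left, unfolded zsc_int]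

lemma additive_reflection: "additive (reflection D \<alpha>)"
  by unfold_locales (simp add: reflection_def pairing_linear zsc_add_left algebra_simps)

lemma reflection_self: "\<alpha> \<in> roots D \<Longrightarrow> reflection D \<alpha> \<alpha> = - \<alpha>"
  using zsc_add_left[of 1 1 \<alpha>] by (simp add: reflection_def pairing_coroot)

lemma uminus_roots: "\<alpha> \<in> roots D \<Longrightarrow> - \<alpha> \<in> roots D"
  using reflection_self reflection_roots by (metis imageI)

lemma reflection_in_roots: "\<alpha> \<in> roots D \<Longrightarrow> \<beta> \<in> roots D \<Longrightarrow> reflection D \<alpha> \<beta> \<in> roots D"
  using reflection_roots by blast

lemma reflection_reflection: "\<alpha> \<in> roots D \<Longrightarrow> reflection D \<alpha> (reflection D \<alpha> x) = x"
  by (simp add: reflection_def pairing_linear pairing_coroot zmod.scale_left_diff_distrib zsc_minus mult.commute)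

lemma reflection_comp_reflection: "\<alpha> \<in> roots D \<Longrightarrow> reflection D \<alpha> \<circ> reflection D \<alpha> = id"
  by (simp add: fun_eq_iff reflection_reflection)

text \<open>Pairing \<open>zsc n \<alpha>\<close> with the coroot of \<open>\<alpha>\<close> gives
  \<open>2 * n\<close>. Infinite order is what later allows cancelling
  \<open>1 - \<theta> (- \<alpha>)\<close>.\<close>

lemma root_infinite_order: "\<lbrakk>\<alpha> \<in> roots D; zsc n \<alpha> = 0\<rbrakk> \<Longrightarrow> n = 0"
  using pairing_linear(10)[of n \<alpha> "coroot D \<alpha>"] by (simp add: pairing_coroot pairing_linear)

lemma pairing_reflection: "pairing D (reflection D \<alpha> x) y = pairing D x (coreflection D \<alpha> y)"
  by (simp add: reflection_def coreflection_def pairing_linear mult.commute)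

text \<open>A Weyl group invariant form on all of \<open>X\<close>, positive on the roots.  It expresses each coroot
  through its root, so \<open>(s\<^sub>\<alpha> \<beta>)\<^sup>\<or>\<close> is determined although the roots need not span \<open>X\<close>.\<close>

definition form :: "'x \<Rightarrow> 'x \<Rightarrow> int" where
  "form x y = (\<Sum>c\<in>coroots D. pairing D x c * pairing D y c)"

lemma form_sym: "form x y = form y x"
  by (simp add: form_def mult.commute)

lemma additive_form: "additive (form x)"
  by unfold_locales (simp add: form_def pairing_linear algebra_simps sum.distrib)

lemma form_sum_zsc:
  "form x (\<Sum>\<alpha>\<in>S. zsc (c \<alpha>) \<alpha>) = (\<Sum>\<alpha>\<in>S. c \<alpha> * form x \<alpha>)"
  by (simp add: additive.sum[OF additive_form] additive_zsc[OF additive_form] zsc_int)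

lemma finite_coroots: "finite (coroots D)"
  by (simp add: coroots_def finite_roots)

text \<open>By adjointness the reflections turn into a coreflection applied to each summation index.
  It maps the finite set of coroots onto itself, hence permutes it.\<close>

lemma form_reflection:
  assumes "\<alpha> \<in> roots D"
  shows "form (reflection D \<alpha> x) (reflection D \<alpha> y) = form x y"
proof -
  have "inj_on (coreflection D \<alpha>) (coroots D)"
    by (rule eq_card_imp_inj_on) (simp_all add: finite_coroots coreflection_coroots assms)
  then show ?thesis
    unfolding form_def pairing_reflection
    using sum.reindex[of "coreflection D \<alpha>" "coroots D" "\<lambda>c. pairing D x c * pairing D y c"]
    by (simp add: coreflection_coroots assms)
qed

text \<open>All summands are squares, and the coroot of \<open>\<alpha>\<close> itself contributes
  4.\<close>

lemma form_root_pos: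
  assumes "\<alpha> \<in> roots D"
  shows "form \<alpha> \<alpha> > 0"
proof -
  have "pairing D \<alpha> (coroot D \<alpha>) * pairing D \<alpha> (coroot D \<alpha>) \<le> form \<alpha> \<alpha>"
    unfolding form_def
    by (rule member_le_sum) (use assms in \<open>auto simp: coroots_def finite_roots\<close>)
  then show ?thesis by (simp add: pairing_coroot assms)
qed

text \<open>Reflecting both arguments sends \<open>\<alpha>\<close> to \<open>- \<alpha>\<close>;
  expanding the reflection of \<open>x\<close> then produces the pairing.\<close>

lemma form_root:
  assumes "\<alpha> \<in> roots D"
  shows "2 * form x \<alpha> = pairing D x (coroot D \<alpha>) * form \<alpha> \<alpha>"
proof -
  have "form x \<alpha> = form (reflection D \<alpha> x) (- \<alpha>)"
    using form_reflection[OF assms, of x \<alpha>] by (simp add: reflection_self assms)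
  also have "\<dots> = - form \<alpha> (x - zsc (pairing D x (coroot D \<alpha>)) \<alpha>)"
    by (simp add: form_sym[of \<alpha>] reflection_def additive.minus[OF additive_form])
  finally show ?thesis
    by (simp add: additive.diff[OF additive_form] additive_zsc[OF additive_form] zsc_int form_sym)
qed

text \<open>Only the coroot of the reflected root has to be identified. \<open>form_root\<close>
  expresses it through the form, whose invariance moves the reflection to the other argument, and
  the positive factor \<open>form \<beta> \<beta>\<close> cancels.\<close>

lemma reflection_conjugate:
  assumes "\<alpha> \<in> roots D" "\<beta> \<in> roots D"
  shows "reflection D (reflection D \<alpha> \<beta>) = reflection D \<alpha> \<circ> reflection D \<beta> \<circ> reflection D \<alpha>"
proof
  fix x
  let ?\<gamma> = "reflection D \<alpha> \<beta>"
  have "pairing D x (coroot D ?\<gamma>) * form \<beta> \<beta> = 2 * form x ?\<gamma>"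
    using form_root[of ?\<gamma> x] by (simp add: form_reflection reflection_in_roots assms)
  also have "\<dots> = 2 * form (reflection D \<alpha> x) \<beta>"
    using form_reflection[OF assms(1), of "reflection D \<alpha> x" \<beta>]
    by (simp add: reflection_reflection assms)
  also have "\<dots> = pairing D (reflection D \<alpha> x) (coroot D \<beta>) * form \<beta> \<beta>"
    by (rule form_root[OF assms(2)])
  finally have eq: "pairing D x (coroot D ?\<gamma>) = pairing D (reflection D \<alpha> x) (coroot D \<beta>)"
    using form_root_pos[OF assms(2)] by simp
  have "reflection D \<alpha> (reflection D \<beta> (reflection D \<alpha> x)) =
      x - zsc (pairing D (reflection D \<alpha> x) (coroot D \<beta>)) ?\<gamma>"
    by (subst (2) reflection_def)
       (simp add: additive.diff[OF additive_reflection] additive_zsc[OF additive_reflection]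
        reflection_reflection assms)
  then show "reflection D ?\<gamma> x = (reflection D \<alpha> \<circ> reflection D \<beta> \<circ> reflection D \<alpha>) x"
    by (simp add: reflection_def[of D ?\<gamma> x] eq)
qed

text \<open>Conjugating the reflection in \<open>\<beta>\<close> by itself avoids computing the
  coroot of \<open>- \<beta>\<close>.\<close>

lemma reflection_uminus: "\<beta> \<in> roots D \<Longrightarrow> reflection D (- \<beta>) = reflection D \<beta>"
  using reflection_conjugate[of \<beta> \<beta>]
  by (simp add: reflection_self reflection_comp_reflection)

section \<open>Positive roots and coefficients with respect to the base\<close>

lemma finite_simple: "finite (simple D)"
  using finite_subset[OF simple_roots finite_roots] .

lemma simple_in_roots: "\<alpha> \<in> simple D \<Longrightarrow> \<alpha> \<in> roots D"
  using simple_roots by blast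

lemma simple_coefficients_unique:
  assumes "(\<Sum>\<alpha>\<in>simple D. zsc (c \<alpha>) \<alpha>) = (\<Sum>\<alpha>\<in>simple D. zsc (d \<alpha>) \<alpha>)" "\<alpha> \<in> simple D"
  shows "c \<alpha> = d \<alpha>"
proof -
  have "(\<Sum>\<alpha>\<in>simple D. zsc (c \<alpha> - d \<alpha>) \<alpha>) = 0"
    using assms(1) by (simp add: zmod.scale_left_diff_distrib sum_subtractf)
  from zmod.independentD[OF simple_independent finite_simple subset_refl this assms(2)]
  show ?thesis by simp
qed

definition positive :: "'x \<Rightarrow> bool" where
  "positive \<beta> \<longleftrightarrow> \<beta> \<in> roots D \<and>
     (\<exists>c. \<beta> = (\<Sum>\<alpha>\<in>simple D. zsc (c \<alpha>) \<alpha>) \<and> (\<forall>\<alpha>\<in>simple D. c \<alpha> \<ge> 0))"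

text \<open>By uniqueness the given expansion is the one from \<open>simple_base\<close>, whose
  coefficients have a common sign; one positive coefficient decides it.\<close>

lemma nonnegative_coefficients:
  assumes "\<beta> \<in> roots D" "\<beta> = (\<Sum>\<alpha>\<in>simple D. zsc (c \<alpha>) \<alpha>)" "\<gamma> \<in> simple D" "c \<gamma> > 0"
  shows "\<forall>\<alpha>\<in>simple D. c \<alpha> \<ge> 0"
proof -
  obtain d where d: "\<beta> = (\<Sum>\<alpha>\<in>simple D. zsc (d \<alpha>) \<alpha>)"
    "(\<forall>\<alpha>\<in>simple D. d \<alpha> \<ge> 0) \<or> (\<forall>\<alpha>\<in>simple D. d \<alpha> \<le> 0)"
    using simple_base[OF assms(1)] by blast
  have "c \<alpha> = d \<alpha>" if "\<alpha> \<in> simple D" for \<alpha>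
    using simple_coefficients_unique[OF trans[OF assms(2)[symmetric] d(1)] that] .
  then show ?thesis using d(2) assms(3,4) by (metis not_le)
qed

lemma root_positive_or: "\<beta> \<in> roots D \<Longrightarrow> positive \<beta> \<or> positive (- \<beta>)"
proof -
  assume \<beta>: "\<beta> \<in> roots D"
  obtain c where c: "\<beta> = (\<Sum>\<alpha>\<in>simple D. zsc (c \<alpha>) \<alpha>)"
    "(\<forall>\<alpha>\<in>simple D. c \<alpha> \<ge> 0) \<or> (\<forall>\<alpha>\<in>simple D. c \<alpha> \<le> 0)"
    using simple_base[OF \<beta>] by blast
  have "- \<beta> = (\<Sum>\<alpha>\<in>simple D. zsc (- c \<alpha>) \<alpha>)"
    by (simp add: zsc_minus sum_negf c(1))
  then show ?thesis
    using c \<beta> uminus_roots[OF \<beta>] unfolding positive_def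
    by (metis neg_0_le_iff_le)
qed

lemma root_nonzero: "\<alpha> \<in> roots D \<Longrightarrow> \<alpha> \<noteq> 0"
  using root_infinite_order[of \<alpha> 1] by auto

lemma positive_uminus:
  assumes "positive \<beta>"
  shows "\<not> positive (- \<beta>)"
proof
  assume "positive (- \<beta>)"
  then obtain d where d: "- \<beta> = (\<Sum>\<alpha>\<in>simple D. zsc (d \<alpha>) \<alpha>)" "\<forall>\<alpha>\<in>simple D. d \<alpha> \<ge> 0"
    unfolding positive_def by blast
  obtain c where c: "\<beta> = (\<Sum>\<alpha>\<in>simple D. zsc (c \<alpha>) \<alpha>)" "\<forall>\<alpha>\<in>simple D. c \<alpha> \<ge> 0"
    using assms unfolding positive_def by blast
  have "\<beta> = (\<Sum>\<alpha>\<in>simple D. zsc (- d \<alpha>) \<alpha>)"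
    using d(1) by (simp add: zsc_minus sum_negf minus_equation_iff[of \<beta>])
  then have "\<forall>\<alpha>\<in>simple D. c \<alpha> = - d \<alpha>"
    using simple_coefficients_unique[OF trans[OF c(1)[symmetric]], of "\<lambda>\<alpha>. - d \<alpha>"] by blast
  then have "\<forall>\<alpha>\<in>simple D. c \<alpha> = 0" using c(2) d(2) by force
  then have "\<beta> = 0" using c(1) by simp
  then show False using assms root_nonzero unfolding positive_def by blast
qed

lemma positive_uminus_iff: "\<beta> \<in> roots D \<Longrightarrow> positive (- \<beta>) \<longleftrightarrow> \<not> positive \<beta>"
  using root_positive_or positive_uminus by blast

lemma simple_positive: "\<alpha> \<in> simple D \<Longrightarrow> positive \<alpha>"
proof -
  assume \<alpha>: "\<alpha> \<in> simple D"
  have "(\<Sum>\<beta>\<in>simple D. zsc (if \<beta> = \<alpha> then 1 else 0) \<beta>) = (\<Sum>\<beta>\<in>simple D. if \<beta> = \<alpha> then \<alpha> else 0)"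
    by (rule sum.cong) auto
  also have "\<dots> = \<alpha>" using \<alpha> finite_simple by simp
  finally show ?thesis using \<alpha> simple_in_roots unfolding positive_def
    by (intro conjI exI[of _ "\<lambda>\<beta>. if \<beta> = \<alpha> then 1 else 0"]) auto
qed

lemma diff_zsc_simple:
  assumes "\<beta> = (\<Sum>\<gamma>\<in>simple D. zsc (c \<gamma>) \<gamma>)" "\<alpha> \<in> simple D"
  shows "\<beta> - zsc n \<alpha> = (\<Sum>\<gamma>\<in>simple D. zsc ((c(\<alpha> := c \<alpha> - n)) \<gamma>) \<gamma>)"
proof -
  have "(\<Sum>\<gamma>\<in>simple D. zsc ((c(\<alpha> := c \<alpha> - n)) \<gamma>) \<gamma>)
      = (\<Sum>\<gamma>\<in>simple D. zsc (c \<gamma>) \<gamma> - (if \<gamma> = \<alpha> then zsc n \<alpha> else 0))"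
    by (rule sum.cong) (auto simp: zmod.scale_left_diff_distrib)
  also have "\<dots> = \<beta> - zsc n \<alpha>"
    using assms finite_simple by (simp add: sum_subtractf)
  finally show ?thesis by simp
qed

text \<open>The reflection changes only the coefficient at \<open>\<alpha>\<close>. As the datum is
  reduced, a root other than \<open>\<alpha>\<close> with nonnegative coefficients has a positive
  coefficient elsewhere, which survives and fixes the sign of all the others.\<close>

lemma simple_reflection_coefficients:
  assumes "\<alpha> \<in> simple D" "\<beta> \<in> roots D" "\<beta> \<noteq> \<alpha>"
    and "\<beta> = (\<Sum>\<gamma>\<in>simple D. zsc (c \<gamma>) \<gamma>)" "\<forall>\<gamma>\<in>simple D. c \<gamma> \<ge> 0"
  defines "d \<equiv> c(\<alpha> := c \<alpha> - pairing D \<beta> (coroot D \<alpha>))"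
  shows "reflection D \<alpha> \<beta> = (\<Sum>\<gamma>\<in>simple D. zsc (d \<gamma>) \<gamma>)" "\<forall>\<gamma>\<in>simple D. d \<gamma> \<ge> 0"
proof -
  show eq: "reflection D \<alpha> \<beta> = (\<Sum>\<gamma>\<in>simple D. zsc (d \<gamma>) \<gamma>)"
    unfolding d_def reflection_def using diff_zsc_simple[OF assms(4,1)] .
  have \<alpha>: "\<alpha> \<in> roots D" using assms(1) simple_in_roots by blast
  have "\<exists>\<gamma>\<in>simple D. \<gamma> \<noteq> \<alpha> \<and> c \<gamma> > 0"
  proof (rule ccontr)
    assume "\<not> ?thesis"
    then have z: "\<forall>\<gamma>\<in>simple D. \<gamma> \<noteq> \<alpha> \<longrightarrow> c \<gamma> = 0" using assms(5) by force
    have "\<beta> = (\<Sum>\<gamma>\<in>simple D. if \<gamma> = \<alpha> then zsc (c \<alpha>) \<alpha> else 0)"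
      unfolding assms(4) by (rule sum.cong) (use z in auto)
    then have b: "\<beta> = zsc (c \<alpha>) \<alpha>" using assms(1) finite_simple by simp
    then have "\<beta> = \<alpha> \<or> \<beta> = - \<alpha>" using reduced[OF \<alpha> assms(2), of 1 "c \<alpha>"] by simp
    \<comment> \<open>Only \<open>\<beta> = - \<alpha>\<close> is left, which would force
      \<open>c \<alpha> = - 1\<close>.\<close>
    then have "zsc (c \<alpha> + 1) \<alpha> = 0" using assms(3) b by (simp add: zsc_Suc)
    then show False using root_infinite_order[OF \<alpha>] assms(1,5) by fastforce
  qed
  then obtain \<gamma> where "\<gamma> \<in> simple D" "d \<gamma> > 0" by (auto simp: d_def)
  then show "\<forall>\<gamma>\<in>simple D. d \<gamma> \<ge> 0"
    using nonnegative_coefficients[OF reflection_in_roots[OF \<alpha> assms(2)] eq] by blast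
qed

lemma simple_reflection_positive:
  assumes "\<alpha> \<in> simple D" "positive \<beta>" "\<beta> \<noteq> \<alpha>"
  shows "positive (reflection D \<alpha> \<beta>)"
proof -
  obtain c where c: "\<beta> = (\<Sum>\<gamma>\<in>simple D. zsc (c \<gamma>) \<gamma>)" "\<forall>\<gamma>\<in>simple D. c \<gamma> \<ge> 0"
    using assms(2) unfolding positive_def by blast
  have "\<beta> \<in> roots D" using assms(2) unfolding positive_def by blast
  from simple_reflection_coefficients[OF assms(1) this assms(3) c]
    reflection_in_roots[OF simple_in_roots[OF assms(1)] this]
  show ?thesis unfolding positive_def by blast
qed

section \<open>Generation of the Weyl group by simple reflections\<close>

abbreviation word :: "'x list \<Rightarrow> 'x \<Rightarrow> 'x" where
  "word as \<equiv> foldr (\<circ>) (map (reflection D) as) id"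

lemma word_append: "word (as @ bs) = word as \<circ> word bs"
  by (induction as) (simp_all add: comp_assoc)

text \<open>A positive non-simple root has positive pairing with some simple coroot, because
  \<open>form \<beta> \<beta> > 0\<close>; reflecting there lowers its height.\<close>

lemma positive_reflection_word:
  assumes "\<beta> \<in> roots D" "\<beta> = (\<Sum>\<alpha>\<in>simple D. zsc (c \<alpha>) \<alpha>)" "\<forall>\<alpha>\<in>simple D. c \<alpha> \<ge> 0"
  shows "\<exists>as. set as \<subseteq> simple D \<and> reflection D \<beta> = word as"
  using assms
proof (induction "nat (\<Sum>\<alpha>\<in>simple D. c \<alpha>)" arbitrary: \<beta> c rule: less_induct)
  case less
  \<comment> \<open>The sum is \<open>form \<beta> \<beta>\<close>, expanded in its second
    argument.\<close>
  have "0 < (\<Sum>\<alpha>\<in>simple D. c \<alpha> * form \<beta> \<alpha>)"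
    using form_root_pos[OF less.prems(1)] form_sum_zsc[of \<beta> c "simple D"]
    unfolding less.prems(2)[symmetric] by linarith
  then obtain \<alpha> where \<alpha>: "\<alpha> \<in> simple D" "c \<alpha> * form \<beta> \<alpha> > 0"
    by (meson not_le sum_nonpos)
  then have \<alpha>r: "\<alpha> \<in> roots D" using simple_in_roots by blast
  have "c \<alpha> \<ge> 0" using \<alpha>(1) less.prems(3) by blast
  then have "form \<beta> \<alpha> > 0" using \<alpha>(2) by (simp add: zero_less_mult_iff)
  then have "pairing D \<beta> (coroot D \<alpha>) * form \<alpha> \<alpha> > 0"
    using form_root[OF \<alpha>r, of \<beta>] by linarith
  then have n: "pairing D \<beta> (coroot D \<alpha>) > 0"
    using form_root_pos[OF \<alpha>r] by (simp add: zero_less_mult_iff)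
  show ?case
  proof (cases "\<beta> = \<alpha>")
    case True
    then show ?thesis using \<alpha>(1) by (intro exI[of _ "[\<alpha>]"]) simp
  next
    case False
    define d where "d = c(\<alpha> := c \<alpha> - pairing D \<beta> (coroot D \<alpha>))"
    note d = simple_reflection_coefficients[OF \<alpha>(1) less.prems(1) False less.prems(2,3), folded d_def]
    have "sum d (simple D) = sum c (simple D) - pairing D \<beta> (coroot D \<alpha>)"
      using \<alpha>(1) finite_simple by (simp add: d_def sum.remove[of _ \<alpha>])
    moreover have "sum d (simple D) \<ge> 0" using d(2) by (intro sum_nonneg) auto
    ultimately have "nat (sum d (simple D)) < nat (sum c (simple D))" using n by linarith
    from less.hyps[OF this reflection_in_roots[OF \<alpha>r less.prems(1)] d]
    obtain as where as: "set as \<subseteq> simple D" "reflection D (reflection D \<alpha> \<beta>) = word as" by blast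
    \<comment> \<open>The conjugation formula is applied to the reflected root, which the reflection
      in \<open>\<alpha>\<close> sends back to \<open>\<beta>\<close>.\<close>
    have "reflection D \<beta> = reflection D \<alpha> \<circ> word as \<circ> reflection D \<alpha>"
      using reflection_conjugate[OF \<alpha>r reflection_in_roots[OF \<alpha>r less.prems(1)]] as(2)
      by (simp add: reflection_reflection \<alpha>r)
    also have "\<dots> = word (\<alpha> # as @ [\<alpha>])"
      using word_append[of as "[\<alpha>]"] by (simp add: comp_assoc del: map_append foldr_append)
    finally show ?thesis using as(1) \<alpha>(1) by (intro exI[of _ "\<alpha> # as @ [\<alpha>]"]) simp
  qed
qed

lemma reflection_word:
  assumes "\<beta> \<in> roots D"
  shows "\<exists>as. set as \<subseteq> simple D \<and> reflection D \<beta> = word as"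
proof (cases "positive \<beta>")
  case True
  then show ?thesis unfolding positive_def using positive_reflection_word by blast
next
  case False
  then have "positive (- \<beta>)" using root_positive_or assms by blast
  then obtain as where "set as \<subseteq> simple D" "reflection D (- \<beta>) = word as"
    unfolding positive_def using positive_reflection_word by blast
  then show ?thesis using reflection_uminus[OF assms] by auto
qed

text \<open>The group is generated by all reflections, while \<open>weyl_length\<close> counts
  simple ones only; this guarantees that its minimum is taken over a nonempty set.\<close>

lemma weyl_word: "w \<in> weyl D \<Longrightarrow> \<exists>as. set as \<subseteq> simple D \<and> w = word as"
proof (induction rule: weyl.induct)
  case weyl_id
  then show ?case by (intro exI[of _ "[]"]) simp
next
  case (weyl_step \<alpha> w)
  then obtain as bs where "set as \<subseteq> simple D" "reflection D \<alpha> = word as"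
     "set bs \<subseteq> simple D" "w = word bs" using reflection_word by blast
  then show ?case by (intro exI[of _ "as @ bs"]) (simp only: word_append set_append Un_subset_iff)
qed

lemma word_weyl: "set as \<subseteq> simple D \<Longrightarrow> word as \<in> weyl D"
  by (induction as) (auto intro: weyl.intros simple_in_roots)

lemma reflection_weyl: "\<alpha> \<in> roots D \<Longrightarrow> reflection D \<alpha> \<in> weyl D"
  using weyl_step[OF _ weyl_id] by simp

section \<open>Sign and length in the Weyl group\<close>

lemma weyl_roots: "w \<in> weyl D \<Longrightarrow> \<beta> \<in> roots D \<Longrightarrow> w \<beta> \<in> roots D"
  by (induction arbitrary: \<beta> rule: weyl.induct) (auto intro: reflection_in_roots)

lemma weyl_uminus: "w \<in> weyl D \<Longrightarrow> w (- x) = - w x"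
  by (induction arbitrary: x rule: weyl.induct)
     (auto simp: additive.minus[OF additive_reflection])

text \<open>For a Weyl group element this is -1 to the number of positive roots made negative.
  Depending on the map and not on a word, it gives an invariant parity of the word length.\<close>

definition weyl_sign :: "('x \<Rightarrow> 'x) \<Rightarrow> int" where
  "weyl_sign w = (\<Prod>\<beta>\<in>{\<beta>. positive \<beta>}. if positive (w \<beta>) then 1 else - 1)"

lemma finite_positive: "finite {\<beta>. positive \<beta>}"
  by (rule finite_subset[OF _ finite_roots]) (auto simp: positive_def)

text \<open>A simple reflection \<open>s\<^sub>\<alpha>\<close> permutes the positive roots other than \<open>\<alpha>\<close>.\<close>

lemma weyl_sign_comp_simple:
  assumes "w \<in> weyl D" "\<alpha> \<in> simple D"
  shows "weyl_sign (w \<circ> reflection D \<alpha>) = - weyl_sign w"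
proof -
  let ?P = "{\<beta>. positive \<beta>} - {\<alpha>}" and ?s = "reflection D \<alpha>"
  let ?\<chi> = "\<lambda>\<beta>. if positive \<beta> then 1 else - 1 :: int"
  have \<alpha>: "\<alpha> \<in> roots D" "positive \<alpha>"
    using assms(2) simple_in_roots simple_positive by auto
  have maps: "?s \<beta> \<in> ?P" if "\<beta> \<in> ?P" for \<beta>
  proof -
    have "?s \<beta> \<noteq> \<alpha>"
    proof
      assume "?s \<beta> = \<alpha>"
      then have "\<beta> = - \<alpha>" using reflection_reflection[OF \<alpha>(1), of \<beta>] reflection_self[OF \<alpha>(1)] by simp
      then show False using that positive_uminus \<alpha>(2) by blast
    qed
    then show ?thesis using that simple_reflection_positive[OF assms(2)] by blast
  qed
  have "(\<Prod>\<beta>\<in>?P. ?\<chi> (w (?s \<beta>))) = (\<Prod>\<beta>\<in>?P. ?\<chi> (w \<beta>))"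
    by (rule prod.reindex_bij_witness[of _ ?s ?s])
       (use maps reflection_reflection[OF \<alpha>(1)] in auto)
  \<comment> \<open>The factor at \<open>\<alpha>\<close> is the only one that changes, because
    \<open>\<alpha>\<close> is sent to its negative.\<close>
  moreover have "?\<chi> (w (?s \<alpha>)) = - ?\<chi> (w \<alpha>)"
    using positive_uminus_iff[OF weyl_roots[OF assms(1) \<alpha>(1)]]
    by (simp add: reflection_self \<alpha> weyl_uminus[OF assms(1)])
  ultimately show ?thesis
    using \<alpha>(2) unfolding weyl_sign_def
    by (simp add: prod.remove[OF finite_positive, of \<alpha>] del: if_split)
qed

text \<open>The induction removes the last letter, since the sign change is known for composition on
  the right.\<close>

lemma weyl_sign_word: "set as \<subseteq> simple D \<Longrightarrow> weyl_sign (word as) = (- 1) ^ length as"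
proof (induction as rule: rev_induct)
  case Nil
  then show ?case by (simp add: weyl_sign_def)
next
  case (snoc \<alpha> as)
  then have as: "set as \<subseteq> simple D" "\<alpha> \<in> simple D" by auto
  have "word (as @ [\<alpha>]) = word as \<circ> reflection D \<alpha>"
    using word_append[of as "[\<alpha>]"] by (simp del: map_append foldr_append)
  then have "weyl_sign (word (as @ [\<alpha>])) = - weyl_sign (word as)"
    using weyl_sign_comp_simple[OF word_weyl[OF as(1)] as(2)] by (simp only:)
  also have "\<dots> = (- 1) ^ length (as @ [\<alpha>])"
    by (simp only: snoc.IH[OF as(1)]) simp
  finally show ?case .
qed

lemma weyl_length_le: "set as \<subseteq> simple D \<Longrightarrow> weyl_length D (word as) \<le> length as"
  unfolding weyl_length_def by (rule Least_le) blast

lemma reduced_word: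
  assumes "w \<in> weyl D"
  obtains as where "set as \<subseteq> simple D" "w = word as" "length as = weyl_length D w"
proof -
  have "\<exists>n as. length as = n \<and> set as \<subseteq> simple D \<and> w = word as"
    using weyl_word[OF assms] by blast
  from LeastI_ex[OF this] show thesis unfolding weyl_length_def[symmetric] using that by blast
qed

lemma weyl_length_id: "weyl_length D id = 0"
  using weyl_length_le[of "[]"] by simp

lemma weyl_sign_length: "w \<in> weyl D \<Longrightarrow> weyl_sign w = (- 1) ^ weyl_length D w"
  by (metis reduced_word weyl_sign_word)

lemma weyl_length_step_le:
  assumes "w \<in> weyl D" "\<alpha> \<in> simple D"
  shows "weyl_length D (reflection D \<alpha> \<circ> w) \<le> weyl_length D w + 1"
proof -
  obtain as where as: "set as \<subseteq> simple D" "w = word as" "length as = weyl_length D w"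
    using reduced_word[OF assms(1)] by blast
  then show ?thesis using weyl_length_le[of "\<alpha> # as"] assms(2) by simp
qed

text \<open>The upper bound, used for \<open>w\<close> and for the reflected element, leaves a
  difference of at most one. Equal lengths would give equal signs.\<close>

lemma weyl_length_step:
  assumes "w \<in> weyl D" "\<alpha> \<in> simple D"
  shows "weyl_length D (reflection D \<alpha> \<circ> w) = weyl_length D w + 1 \<or>
    weyl_length D w = weyl_length D (reflection D \<alpha> \<circ> w) + 1"
proof -
  let ?u = "reflection D \<alpha> \<circ> w"
  have \<alpha>: "\<alpha> \<in> roots D" using assms(2) simple_in_roots by blast
  have u: "?u \<in> weyl D" using weyl_step[OF \<alpha> assms(1)] .
  have "reflection D \<alpha> \<circ> ?u = w" by (simp add: fun_eq_iff reflection_reflection \<alpha>)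
  then have "weyl_length D w \<le> weyl_length D ?u + 1"
    using weyl_length_step_le[OF u assms(2)] by simp
  moreover have "weyl_length D ?u \<le> weyl_length D w + 1"
    using weyl_length_step_le[OF assms] .
  moreover have "weyl_length D ?u \<noteq> weyl_length D w"
  proof -
    obtain as where as: "set as \<subseteq> simple D" "w = word as" using reduced_word[OF assms(1)] by blast
    \<comment> \<open>Comparing words handles composition on the left: \<open>\<alpha> # as\<close>
      has one letter more than \<open>as\<close>.\<close>
    then have "weyl_sign ?u = - weyl_sign w"
      using weyl_sign_word[of as] weyl_sign_word[of "\<alpha> # as"] assms(2) by simp
    then show ?thesis
      using weyl_sign_length[OF u] weyl_sign_length[OF assms(1)] by auto
  qed
  ultimately show ?thesis by linarith
qed

lemma weyl_length_simple: "\<alpha> \<in> simple D \<Longrightarrow> weyl_length D (reflection D \<alpha>) = 1"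
  using weyl_length_step[OF weyl_id, of \<alpha>] by (simp add: weyl_length_id)

end


section \<open>The affine Hecke algebra\<close>

context complex_algebra
begin

lemma mult_span_left:
  assumes "h \<in> span B" "subspace S" "\<And>b. b \<in> B \<Longrightarrow> a * b \<in> S"
  shows "a * h \<in> S"
  using assms(1)
  by (induction rule: span_induct_alt)
     (auto simp: distrib_left scale_mult_right assms subspace_0 intro!: subspace_add subspace_scale)

lemma mult_span_right:
  assumes "h \<in> span B" "subspace S" "\<And>b. b \<in> B \<Longrightarrow> b * a \<in> S"
  shows "h * a \<in> S"
  using assms(1)
  by (induction rule: span_induct_alt)
     (auto simp: distrib_right scale_mult_left assms subspace_0 intro!: subspace_add subspace_scale)

end

section \<open>Units and products of the elements \<open>T w\<close>\<close>

context affine_hecke_algebra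
begin

text \<open>\<open>\<theta> 0\<close> fixes every basis element under left multiplication, hence
  every element, in particular 1.\<close>

lemma theta_zero [simp]: "\<theta> 0 = 1"
proof -
  have "\<theta> 0 * h = h" for h
  proof -
    have "h \<in> span {\<theta> x * T w | x w. w \<in> weyl D}" using basis_span by simp
    then show ?thesis
      by (induction rule: span_induct_alt)
         (auto simp: distrib_left scale_mult_right mult.assoc[symmetric] theta_mult)
  qed
  from this[of 1] show ?thesis by simp
qed

text \<open>The identity has length 0, so \<open>T id\<close> fixes the basis under right
  multiplication.\<close>

lemma T_id [simp]: "T id = 1"
proof -
  have *: "T w * T id = T w" if "w \<in> weyl D" for w
    using T_mult[OF that weyl_id] by (simp add: weyl_length_id)
  have "h * T id = h" for h
  proof -
    have "h \<in> span {\<theta> x * T w | x w. w \<in> weyl D}" using basis_span by simp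
    then show ?thesis
    proof (induction rule: span_induct_alt)
      case (step c b h)
      then obtain x w where b: "b = \<theta> x * T w" "w \<in> weyl D" by blast
      have "b * T id = b" by (simp only: b(1) mult.assoc *[OF b(2)])
      then show ?case using step.IH by (simp only: distrib_right scale_mult_left)
    qed simp
  qed
  from this[of 1] show ?thesis by simp
qed

text \<open>If the length grows, this is the product relation. Otherwise \<open>T w\<close> itself
  factors with \<open>T (reflection D \<alpha>)\<close> on the left, and the quadratic relation
  rewrites the resulting square.\<close>

lemma T_simple_mult:
  assumes "\<alpha> \<in> simple D" "w \<in> weyl D"
  shows "T (reflection D \<alpha>) * T w \<in> span (T ` weyl D)"
proof -
  let ?s = "reflection D \<alpha>"
  have \<alpha>: "\<alpha> \<in> roots D" using assms(1) simple_in_roots by blast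
  have u: "?s \<circ> w \<in> weyl D" using weyl_step[OF \<alpha> assms(2)] .
  consider "weyl_length D (?s \<circ> w) = weyl_length D w + 1"
    | "weyl_length D w = weyl_length D (?s \<circ> w) + 1"
    using weyl_length_step[OF assms(2,1)] by blast
  then show ?thesis
  proof cases
    case 1
    then have "T ?s * T w = T (?s \<circ> w)"
      using T_mult[OF reflection_weyl[OF \<alpha>] assms(2)] by (simp add: weyl_length_simple assms(1))
    then show ?thesis using u by (auto intro: span_base)
  next
    case 2
    have w: "?s \<circ> (?s \<circ> w) = w" by (simp add: fun_eq_iff reflection_reflection \<alpha>)
    then have Tw: "T ?s * T (?s \<circ> w) = T w"
      using T_mult[OF reflection_weyl[OF \<alpha>] u] 2 by (simp add: weyl_length_simple assms(1))
    let ?c = "complex_of_real (q powr lam \<alpha>)"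
    have "T ?s * T ?s = scale ?c (T ?s) - T ?s + scale ?c 1"
      using T_quadratic[OF assms(1)] by (simp add: algebra_simps scale_mult_right)
    then have "T ?s * T w = (scale ?c (T ?s) - T ?s + scale ?c 1) * T (?s \<circ> w)"
      by (simp add: Tw[symmetric] mult.assoc[symmetric])
    also have "\<dots> = scale ?c (T w) - T w + scale ?c (T (?s \<circ> w))"
      by (simp add: algebra_simps scale_mult_left Tw)
    finally show ?thesis using u assms(2) by (simp add: span_add span_diff span_scale span_base)
  qed
qed

section \<open>Division by \<open>1 - \<theta> \<beta>\<close> and the Bernstein relation\<close>

text \<open>Since \<open>T id = 1\<close>, each \<open>\<theta> x\<close> is one of the basis
  elements.\<close>

lemma independent_theta: "independent (range \<theta>)" and inj_theta: "inj \<theta>"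
proof -
  have "\<theta> x = \<theta> x * T id" for x by simp
  then have "range \<theta> \<subseteq> {\<theta> x * T w | x w. w \<in> weyl D}" using weyl_id by blast
  then show "independent (range \<theta>)" using basis_independent independent_mono by blast
  show "inj \<theta>"
  proof (rule injI)
    fix x y assume "\<theta> x = \<theta> y"
    then show "x = y" using inj_onD[OF basis_distinct, of "(x, id)" "(y, id)"] weyl_id[of D] by simp
  qed
qed

text \<open>If \<open>d = d \<theta>\<^sub>\<beta>\<close>, the coefficients of \<open>d\<close> are periodic with period \<open>\<beta>\<close> and finitely many are
  nonzero.\<close>

lemma theta_cancel:
  assumes d: "d \<in> span (range \<theta>)" and eq: "d * (1 - \<theta> \<beta>) = 0"
    and \<beta>: "\<And>n. zsc n \<beta> = 0 \<Longrightarrow> n = 0"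
  shows "d = 0"
proof (rule ccontr)
  assume "d \<noteq> 0"
  let ?r = "representation (range \<theta>)"
  \<comment> \<open>Multiplication by \<open>\<theta> \<beta>\<close> translates coefficients by
    \<open>\<beta>\<close>. Both memberships are carried through the induction because additivity of
    \<open>representation\<close> requires them.\<close>
  have shift: "e \<in> span (range \<theta>) \<and> e * \<theta> \<beta> \<in> span (range \<theta>) \<and>
      ?r (e * \<theta> \<beta>) (\<theta> (x + \<beta>)) = ?r e (\<theta> x)"
    if "e \<in> span (range \<theta>)" for e x
    using that
  proof (induction rule: span_induct_alt)
    case base
    then show ?case by (simp add: representation_zero span_zero)
  next
    case (step c b e)
    then obtain y where y: "b = \<theta> y" by blast
    with step y show ?case
      by (auto simp: distrib_right scale_mult_left theta_mult representation_add representation_scale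
          representation_basis independent_theta span_base span_scale inj_eq[OF inj_theta]
          intro: span_add span_scale)
  qed
  have period: "?r d (\<theta> (x + \<beta>)) = ?r d (\<theta> x)" for x
    using shift[OF d, of x] eq by (simp add: algebra_simps)
  have "\<exists>b. ?r d b \<noteq> 0"
    using sum_nonzero_representation_eq[OF independent_theta d] \<open>d \<noteq> 0\<close> sum.empty
    by (metis (mono_tags, lifting) empty_Collect_eq)
  then obtain x where x: "?r d (\<theta> x) \<noteq> 0"
    using representation_ne_zero by (metis imageE)
  have "?r d (\<theta> (x + zsc (int n) \<beta>)) \<noteq> 0" for n
  proof (induction n)
    case 0
    then show ?case using x by simp
  next
    case (Suc n)
    then show ?case
      using period[of "x + zsc (int n) \<beta>"] zsc_Suc[of "int n" \<beta>] by (simp add: algebra_simps)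
  qed
  then have "range (\<lambda>n. \<theta> (x + zsc (int n) \<beta>)) \<subseteq> {b. ?r d b \<noteq> 0}" by blast
  moreover have "inj (\<lambda>n. \<theta> (x + zsc (int n) \<beta>))"
  proof (rule injI)
    fix m n assume "\<theta> (x + zsc (int m) \<beta>) = \<theta> (x + zsc (int n) \<beta>)"
    then have "zsc (int m - int n) \<beta> = 0" by (simp add: inj_eq[OF inj_theta] zmod.scale_left_diff_distrib)
    then show "m = n" using \<beta>[of "int m - int n"] by simp
  qed
  ultimately show False
    using finite_representation[of "range \<theta>" d] by (meson finite_imageD finite_subset infinite_UNIV_nat)
qed

text \<open>The description in \<open>theta_fraction\<close> is unique: the difference of two
  quotients is annihilated by \<open>1 - \<theta> \<beta>\<close>, so \<open>theta_cancel\<close>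
  applies.\<close>

lemma theta_fraction_eq:
  assumes "d \<in> span (range \<theta>)" "d * (1 - \<theta> \<beta>) = a" "\<And>n. zsc n \<beta> = 0 \<Longrightarrow> n = 0"
  shows "theta_fraction scale \<theta> a (1 - \<theta> \<beta>) = d"
  unfolding theta_fraction_def
proof (rule the_equality)
  show "d \<in> span (range \<theta>) \<and> d * (1 - \<theta> \<beta>) = a" using assms by blast
next
  fix e assume e: "e \<in> span (range \<theta>) \<and> e * (1 - \<theta> \<beta>) = a"
  then have "(e - d) * (1 - \<theta> \<beta>) = 0" using assms(2) by (simp add: left_diff_distrib)
  from theta_cancel[OF _ this assms(3)] show "e = d" using e assms(1) span_diff by simp
qed

text \<open>A finite geometric series with ratio \<open>\<theta> (- \<beta>)\<close>.\<close>

lemma theta_telescope: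
  "(\<Sum>i<m. \<theta> (z - zsc (int i) \<beta>)) * (1 - \<theta> (- \<beta>)) = \<theta> z - \<theta> (z - zsc (int m) \<beta>)"
proof (induction m)
  case 0
  then show ?case by simp
next
  case (Suc m)
  have "\<theta> (z - zsc (int m) \<beta>) * (1 - \<theta> (- \<beta>)) =
      \<theta> (z - zsc (int m) \<beta>) - \<theta> (z - zsc (int (Suc m)) \<beta>)"
    using zsc_Suc[of "int m" \<beta>] by (simp add: right_diff_distrib theta_mult diff_diff_eq add.commute)
  then show ?case by (simp add: distrib_right Suc del: of_nat_Suc)
qed

lemma theta_fraction_in_span:
  assumes \<beta>: "\<And>n. zsc n \<beta> = 0 \<Longrightarrow> n = 0"
  shows "theta_fraction scale \<theta> (\<theta> x - \<theta> (x - zsc n \<beta>)) (1 - \<theta> (- \<beta>))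
    \<in> span (range (\<lambda>k. \<theta> (x - zsc k \<beta>)))"
proof -
  let ?S = "span (range (\<lambda>k. \<theta> (x - zsc k \<beta>)))"
  have "\<exists>d \<in> ?S. d * (1 - \<theta> (- \<beta>)) = \<theta> x - \<theta> (x - zsc n \<beta>)"
  proof (cases "n \<ge> 0")
    case True
    then show ?thesis
      using theta_telescope[where m = "nat n" and z = x and \<beta> = \<beta>]
      by (intro bexI[of _ "\<Sum>i<nat n. \<theta> (x - zsc (int i) \<beta>)"]) (auto intro: span_sum span_base)
  next
    case False
    \<comment> \<open>For negative \<open>n\<close> the series starts at
      \<open>x - zsc n \<beta>\<close> and ends at \<open>x\<close>, giving the numerator with the
      opposite sign.\<close>
    have "\<theta> (x - zsc n \<beta> - zsc (int i) \<beta>) \<in> ?S" for i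
    proof -
      have "x - zsc n \<beta> - zsc (int i) \<beta> = x - zsc (n + int i) \<beta>"
        by (simp add: zsc_add_left algebra_simps)
      then show ?thesis by (metis rangeI span_base)
    qed
    then show ?thesis
      using False theta_telescope[where m = "nat (- n)" and z = "x - zsc n \<beta>" and \<beta> = \<beta>]
      by (intro bexI[of _ "- (\<Sum>i<nat (- n). \<theta> (x - zsc n \<beta> - zsc (int i) \<beta>))"])
         (auto intro!: span_neg span_sum simp: zsc_minus)
  qed
  then obtain d where d: "d \<in> ?S" "d * (1 - \<theta> (- \<beta>)) = \<theta> x - \<theta> (x - zsc n \<beta>)" by blast
  have "?S \<subseteq> span (range \<theta>)" by (rule span_mono) blast
  then have "theta_fraction scale \<theta> (\<theta> x - \<theta> (x - zsc n \<beta>)) (1 - \<theta> (- \<beta>)) = d"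
    using d \<beta> by (intro theta_fraction_eq) (auto simp: zmod.scale_minus_right)
  then show ?thesis using d by simp
qed

text \<open>The correction term is a combination of translates of \<open>\<theta> x\<close> by
  multiples of \<open>\<alpha>\<close>. For an even coroot \<open>y + y\<close> the reflection
  subtracts a multiple of \<open>\<alpha> + \<alpha>\<close>, so the same division works with the
  doubled root.\<close>

lemma bernstein_span:
  assumes "\<alpha> \<in> simple D"
  shows "\<exists>e \<in> span (range (\<lambda>k. \<theta> (x - zsc k \<alpha>))).
    T (reflection D \<alpha>) * \<theta> x = \<theta> (reflection D \<alpha> x) * T (reflection D \<alpha>) + e"
proof (cases "coroot_even D \<alpha>")
  case False
  have "\<alpha> \<in> roots D" using assms simple_in_roots by blast
  then show ?thesis
    using bernstein_odd[OF assms False, of x] theta_fraction_in_span[of \<alpha> x]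
      root_infinite_order[of \<alpha>]
    by (auto simp: reflection_def intro!: span_scale)
next
  case True
  have \<alpha>: "\<alpha> \<in> roots D" using assms simple_in_roots by blast
  obtain y where y: "coroot D \<alpha> = y + y" using True by (auto simp: coroot_even_def)
  have twice: "zsc k (\<alpha> + \<alpha>) = zsc (2 * k) \<alpha>" for k
    using zsc_add_left[of k k \<alpha>] by (simp add: zsc_add_right)
  have order: "n = 0" if "zsc n (\<alpha> + \<alpha>) = 0" for n
    using root_infinite_order[OF \<alpha>, of "2 * n"] that by (simp add: twice)
  have eq: "reflection D \<alpha> x = x - zsc (pairing D x y) (\<alpha> + \<alpha>)"
    by (simp add: reflection_def y pairing_linear twice)
  let ?d = "theta_fraction scale \<theta> (\<theta> x - \<theta> (reflection D \<alpha> x)) (1 - \<theta> (- (\<alpha> + \<alpha>)))"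
  let ?S = "span (range (\<lambda>k. \<theta> (x - zsc k \<alpha>)))"
  have d: "?d \<in> span (range (\<lambda>k. \<theta> (x - zsc k (\<alpha> + \<alpha>))))"
    unfolding eq by (rule theta_fraction_in_span) (rule order)
  have "range (\<lambda>k. \<theta> (x - zsc k (\<alpha> + \<alpha>))) \<subseteq> range (\<lambda>k. \<theta> (x - zsc k \<alpha>))"
    by (auto simp: twice)
  then have "?d \<in> ?S" using d span_mono by blast
  moreover have "\<theta> (- \<alpha>) * ?d \<in> ?S"
  proof (rule mult_span_left[OF d subspace_span])
    fix b assume "b \<in> range (\<lambda>k. \<theta> (x - zsc k (\<alpha> + \<alpha>)))"
    then obtain k where "b = \<theta> (x - zsc k (\<alpha> + \<alpha>))" by blast
    \<comment> \<open>The extra factor turns even multiples of \<open>\<alpha>\<close> into odd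
      ones.\<close>
    then have "\<theta> (- \<alpha>) * b = \<theta> (x - zsc (2 * k + 1) \<alpha>)"
      by (simp add: theta_mult twice zsc_Suc diff_diff_eq del: zmod.scale_right_distrib)
    then show "\<theta> (- \<alpha>) * b \<in> ?S" by (auto intro: span_base)
  qed
  ultimately have "(scale a 1 + scale b (\<theta> (- \<alpha>))) * ?d \<in> ?S" for a b
    by (simp add: distrib_right scale_mult_left span_add span_scale)
  then show ?thesis
    unfolding bernstein_even[OF assms True, of x] by (rule bexI[rotated]) (rule refl)
qed

section \<open>Products of components\<close>

text \<open>An arbitrary set of weights replaces the coset: the product rule uses only stability
  under translation by multiples of simple roots.\<close>

definition component :: "'x set \<Rightarrow> 'h set" where
  "component C = span {\<theta> x * T w | x w. x \<in> C \<and> w \<in> weyl D}"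

lemma subspace_component: "subspace (component C)"
  by (simp add: component_def)

lemma theta_mult_component:
  assumes "h \<in> component C" "\<And>y. y \<in> C \<Longrightarrow> x + y \<in> C'"
  shows "\<theta> x * h \<in> component C'"
proof (rule mult_span_left[OF assms(1)[unfolded component_def] subspace_component])
  fix b assume "b \<in> {\<theta> x * T w | x w. x \<in> C \<and> w \<in> weyl D}"
  then obtain y w where "b = \<theta> y * T w" "y \<in> C" "w \<in> weyl D" by blast
  then show "\<theta> x * b \<in> component C'"
    using assms(2) by (auto simp: component_def mult.assoc[symmetric] theta_mult intro!: span_base)
qed

text \<open>Moving the simple element past \<open>\<theta> x\<close> leaves a term handled by
  \<open>T_simple_mult\<close> and a correction times \<open>T w\<close>. The weights in both differ
  from \<open>x\<close> by multiples of \<open>\<alpha>\<close>.\<close>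

lemma T_simple_component:
  assumes "\<alpha> \<in> simple D" "\<And>x n. x \<in> C \<Longrightarrow> x - zsc n \<alpha> \<in> C" "h \<in> component C"
  shows "T (reflection D \<alpha>) * h \<in> component C"
proof (rule mult_span_left[OF assms(3)[unfolded component_def] subspace_component])
  fix b assume "b \<in> {\<theta> x * T w | x w. x \<in> C \<and> w \<in> weyl D}"
  then obtain x w where b: "b = \<theta> x * T w" "x \<in> C" "w \<in> weyl D" by blast
  let ?s = "reflection D \<alpha>"
  obtain e where e: "e \<in> span (range (\<lambda>k. \<theta> (x - zsc k \<alpha>)))" "T ?s * \<theta> x = \<theta> (?s x) * T ?s + e"
    using bernstein_span[OF assms(1)] by blast
  have "\<theta> (?s x) * (T ?s * T w) \<in> component C"
  proof (rule mult_span_left[OF T_simple_mult[OF assms(1) b(3)] subspace_component])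
    fix t assume "t \<in> T ` weyl D"
    then show "\<theta> (?s x) * t \<in> component C"
      using assms(2)[OF b(2)] by (auto simp: component_def reflection_def intro!: span_base)
  qed
  moreover have "e * T w \<in> component C"
  proof (rule mult_span_right[OF e(1) subspace_component])
    fix t assume "t \<in> range (\<lambda>k. \<theta> (x - zsc k \<alpha>))"
    then show "t * T w \<in> component C"
      using assms(2)[OF b(2)] b(3) by (auto simp: component_def intro!: span_base)
  qed
  ultimately show "T ?s * b \<in> component C"
    using subspace_add[OF subspace_component]
    by (simp add: b(1) mult.assoc[symmetric] e(2) distrib_right)
qed

text \<open>Removing the first letter of a reduced word factors \<open>T w\<close> into a simple
  element and an element of smaller length.\<close>

lemma T_component:
  assumes "w \<in> weyl D" "\<And>x n \<alpha>. \<alpha> \<in> simple D \<Longrightarrow> x \<in> C \<Longrightarrow> x - zsc n \<alpha> \<in> C" "h \<in> component C"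
  shows "T w * h \<in> component C"
  using assms(1)
proof (induction "weyl_length D w" arbitrary: w)
  case 0
  then obtain as where "w = word as" "length as = 0"
    using reduced_word by metis
  then have "w = id" by (simp only: length_0_conv list.map foldr_Nil id_apply)
  then show ?case using assms(3) by (simp only: T_id mult_1_left)
next
  case (Suc n)
  obtain as where as: "set as \<subseteq> simple D" "w = word as" "length as = weyl_length D w"
    using reduced_word[OF Suc.prems] .
  then obtain \<alpha> bs where bs: "as = \<alpha> # bs" using Suc.hyps(2) by (cases as) auto
  let ?u = "word bs"
  have \<alpha>: "\<alpha> \<in> simple D" and u: "?u \<in> weyl D" using as bs word_weyl[of bs] by auto
  have w: "w = reflection D \<alpha> \<circ> ?u" using as bs by simp
  have "weyl_length D ?u \<le> n" using weyl_length_le[of bs] as bs Suc.hyps(2) by simp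
  \<comment> \<open>The tail is again reduced, as one letter raises the length by at most
    one.\<close>
  then have l: "weyl_length D ?u = n"
    using weyl_length_step_le[OF u \<alpha>] Suc.hyps(2) w by simp
  then have "T w = T (reflection D \<alpha>) * T ?u"
    using T_mult[OF reflection_weyl u] w Suc.hyps(2) simple_in_roots[OF \<alpha>]
    by (simp add: weyl_length_simple[OF \<alpha>])
  then show ?case
    using T_simple_component[OF \<alpha> assms(2)[OF \<alpha>] Suc.hyps(1)[OF l[symmetric] u]]
    by (simp add: mult.assoc)
qed

text \<open>In \<open>\<theta> x * (T w * b)\<close> the factor \<open>T w\<close> acts first and
  preserves the component of \<open>b\<close>; then \<open>\<theta> x\<close> translates it.\<close>

lemma component_mult:
  assumes "a \<in> component C" "b \<in> component C'"
    and "\<And>x n \<alpha>. \<alpha> \<in> simple D \<Longrightarrow> x \<in> C' \<Longrightarrow> x - zsc n \<alpha> \<in> C'"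
  shows "a * b \<in> component (C + C')"
proof (rule mult_span_right[OF assms(1)[unfolded component_def] subspace_component])
  fix h assume "h \<in> {\<theta> x * T w | x w. x \<in> C \<and> w \<in> weyl D}"
  then obtain x w where h: "h = \<theta> x * T w" "x \<in> C" "w \<in> weyl D" by blast
  have "\<theta> x * (T w * b) \<in> component (C + C')"
    by (rule theta_mult_component[OF T_component[OF h(3) assms(3,2)]])
       (use h(2) in \<open>auto intro: set_plus_intro\<close>)
  then show "h * b \<in> component (C + C')" by (simp add: h(1) mult.assoc)
qed

end


section \<open>The grading\<close>

text \<open>Existence groups a basis expansion of \<open>h\<close> by degree. For uniqueness, the
  projection \<open>P g\<close> keeps basis vectors of degree \<open>g\<close> and kills the others,
  so it recovers each part from \<open>h\<close>.\<close>

lemma (in vector_space) unique_decomposition_by_degree: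
  assumes B: "independent B" "span B = UNIV" and deg: "deg ` B \<subseteq> G"
  shows "\<exists>!c. finite {g. c g \<noteq> 0} \<and> {g. c g \<noteq> 0} \<subseteq> G \<and>
    (\<forall>g\<in>G. c g \<in> span {b \<in> B. deg b = g}) \<and> h = (\<Sum>g\<in>{g. c g \<noteq> 0}. c g)"
proof -
  interpret vector_space_pair scale scale ..
  define P where "P g = construct B (\<lambda>b. if deg b = g then b else 0)" for g
  have lin: "Vector_Spaces.linear scale scale (P g)" for g
    unfolding P_def using B(1) by (rule linear_construct)
  have P_basis: "P g b = (if deg b = g then b else 0)" if "b \<in> B" for g b
    unfolding P_def using B(1) that by (rule construct_basis)
  have P: "P g x = (if g = g' then x else 0)" if "x \<in> span {b \<in> B. deg b = g'}" for g g' x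
    using that
    by (induction rule: span_induct_alt)
       (auto simp: linear_0[OF lin] linear_add[OF lin] linear_scale[OF lin] P_basis)
  obtain F r where F: "finite F" "F \<subseteq> B" "h = (\<Sum>b\<in>F. scale (r b) b)"
    using B(2) unfolding span_explicit by blast
  define c where "c g = (\<Sum>b\<in>{b \<in> F. deg b = g}. scale (r b) b)" for g
  let ?decomposition = "\<lambda>d. finite {g. d g \<noteq> 0} \<and> {g. d g \<noteq> 0} \<subseteq> G \<and>
    (\<forall>g\<in>G. d g \<in> span {b \<in> B. deg b = g}) \<and> h = (\<Sum>g\<in>{g. d g \<noteq> 0}. d g)"
  have sub: "{g. c g \<noteq> 0} \<subseteq> deg ` F"
  proof -
    have "c g = 0" if "g \<notin> deg ` F" for g
    proof -
      have "{b \<in> F. deg b = g} = {}" using that by blast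
      then show ?thesis by (simp only: c_def sum.empty)
    qed
    then show ?thesis by blast
  qed
  have "c g \<in> span {b \<in> B. deg b = g}" for g
    unfolding c_def using F(2) by (intro span_sum span_scale span_base) auto
  moreover have "h = (\<Sum>g\<in>{g. c g \<noteq> 0}. c g)"
  proof -
    \<comment> \<open>Some degrees occurring in \<open>F\<close> may have zero part; they are
      dropped afterwards.\<close>
    have "h = (\<Sum>g\<in>deg ` F. c g)"
      unfolding c_def F(3) by (rule sum.image_gen[OF F(1)])
    also have "\<dots> = (\<Sum>g\<in>{g. c g \<noteq> 0}. c g)"
      using sub F(1) by (intro sum.mono_neutral_right) auto
    finally show ?thesis .
  qed
  moreover have "finite {g. c g \<noteq> 0}" "{g. c g \<noteq> 0} \<subseteq> G"
    using sub F(1,2) deg by (auto intro: finite_subset)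
  ultimately have c: "?decomposition c" by blast
  have projection: "d g = P g h" if d: "?decomposition d" for d g
  proof -
    have "P g h = (\<Sum>g'\<in>{g. d g \<noteq> 0}. P g (d g'))"
      using d by (metis linear_sum[OF lin])
    also have "\<dots> = (\<Sum>g'\<in>{g. d g \<noteq> 0}. if g = g' then d g' else 0)"
    proof (rule sum.cong[OF refl])
      fix g' assume "g' \<in> {g. d g \<noteq> 0}"
      then have "d g' \<in> span {b \<in> B. deg b = g'}" using d by blast
      then show "P g (d g') = (if g = g' then d g' else 0)" by (rule P)
    qed
    also have "\<dots> = d g" using d by simp
    finally show ?thesis by simp
  qed
  show ?thesis
  proof (rule ex1I)
    show "?decomposition c" by (rule c)
    show "d = c" if "?decomposition d" for d
      using projection[OF that] projection[OF c] by (simp add: fun_eq_iff)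
  qed
qed

section \<open>Comparison of the two Weyl groups\<close>

context central_hecke_morphism
begin

lemma f_roots: "f ` roots D1 = roots D2" and f_simple: "f ` simple D1 = simple D2"
  using root_datum_morphism
  by (simp_all add: central_root_datum_morphism_def bij_betw_imp_surj_on)

lemma weyl_identification_weyl:
  "(w, w') \<in> weyl_identification D1 D2 f \<Longrightarrow> w \<in> weyl D1 \<and> w' \<in> weyl D2"
proof (induction rule: weyl_identification.induct)
  case (ident_step \<alpha> w w')
  then show ?case using f_roots by (blast intro: weyl.intros)
qed (blast intro: weyl.intros)

lemma weyl_identification_left:
  "w \<in> weyl D1 \<Longrightarrow> \<exists>w'. (w, w') \<in> weyl_identification D1 D2 f"
  by (induction rule: weyl.induct) (blast intro: weyl_identification.intros)+

lemma weyl_identification_right: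
  "w' \<in> weyl D2 \<Longrightarrow> \<exists>w. (w, w') \<in> weyl_identification D1 D2 f"
proof (induction rule: weyl.induct)
  case weyl_id
  then show ?case by (blast intro: weyl_identification.intros)
next
  case (weyl_step \<beta> w')
  then obtain \<alpha> where "\<alpha> \<in> roots D1" "\<beta> = f \<alpha>"
    using f_roots by blast
  then show ?case using weyl_step by (blast intro: weyl_identification.intros)
qed

lemma additive_f: "additive f"
  using root_datum_morphism by (simp add: central_root_datum_morphism_def)

text \<open>Perfectness of the pairing of \<open>D1\<close> makes the description in
  \<open>transpose\<close> well defined.\<close>

lemma pairing_transpose: "pairing D2 (f x) y = pairing D1 x (transpose D1 D2 f y)"
proof -
  have "additive (\<lambda>x. pairing D2 (f x) y)"
    by unfold_locales (simp add: additive.add[OF additive_f] H2.pairing_linear)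
  then have "\<exists>!y'. \<forall>x. pairing D1 x y' = pairing D2 (f x) y"
    using H1.perfect by (simp add: perfect_pairing_def)
  then have "\<exists>!y'. \<forall>x. pairing D2 (f x) y = pairing D1 x y'" by (simp add: eq_commute)
  from theI'[OF this] show ?thesis unfolding transpose_def by blast
qed

text \<open>For one reflection this holds because the transpose carries the coroot of
  \<open>f \<alpha>\<close> to that of \<open>\<alpha>\<close>.\<close>

lemma weyl_identification_equivariant:
  "(w, w') \<in> weyl_identification D1 D2 f \<Longrightarrow> w' (f x) = f (w x)"
proof (induction arbitrary: x rule: weyl_identification.induct)
  case (ident_step \<alpha> w w')
  have "transpose D1 D2 f (coroot D2 (f \<alpha>)) = coroot D1 \<alpha>"
    using root_datum_morphism ident_step(1) by (simp add: central_root_datum_morphism_def)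
  then show ?case
    by (simp add: ident_step.IH reflection_def pairing_transpose additive.diff[OF additive_f]
        additive_zsc[OF additive_f])
qed simp

lemma simple_in_range: "\<alpha> \<in> simple D2 \<Longrightarrow> \<alpha> \<in> range f"
  using f_simple by blast

section \<open>Cosets of the image and the grading\<close>

lemma coset_add: "x +o range f + (y +o range f) = (x + y) +o range f"
proof -
  have "range f + range f = range f"
    by (auto simp: set_plus_def additive.add[OF additive_f, symmetric])
       (metis add.right_neutral additive.zero[OF additive_f] rangeI)
  then show ?thesis by (simp add: set_plus_rearrange)
qed

lemma coset_eq_iff: "x +o range f = y +o range f \<longleftrightarrow> x \<in> y +o range f"
proof
  have "x \<in> x +o range f"
    using additive.zero[OF additive_f] by (auto simp: elt_set_plus_def intro: exI[of _ 0])
  then show "x +o range f = y +o range f \<Longrightarrow> x \<in> y +o range f" by simp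
next
  assume "x \<in> y +o range f"
  then obtain z where z: "x = y + f z" by (auto simp: elt_set_plus_def)
  have "f z +o range f = range f"
  proof
    show "f z +o range f \<subseteq> range f"
      by (auto simp: elt_set_plus_def additive.add[OF additive_f, symmetric])
    show "range f \<subseteq> f z +o range f"
    proof
      fix u assume "u \<in> range f"
      then obtain v where "u = f v" by blast
      then have "u = f z + f (v - z)" by (simp add: additive.diff[OF additive_f])
      then show "u \<in> f z +o range f" by (auto simp: elt_set_plus_def)
    qed
  qed
  then show "x +o range f = y +o range f"
    by (simp add: z set_plus_rearrange2[symmetric])
qed

lemma hecke_component_eq:
  assumes "g \<in> cokernel f"
  shows "hecke_component f D2 scale2 \<theta>2 T2 g = H2.component g"
proof -
  have "x +o range f = g \<longleftrightarrow> x \<in> g" for x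
    using assms coset_eq_iff unfolding cokernel_def by blast
  then show ?thesis by (simp add: hecke_component_def H2.component_def)
qed

text \<open>Simple roots of \<open>D2\<close> lie in the image of \<open>f\<close>, so these
  translations preserve cosets.\<close>

lemma cokernel_closed:
  assumes "g \<in> cokernel f" "\<alpha> \<in> simple D2" "x \<in> g"
  shows "x - zsc n \<alpha> \<in> g"
proof -
  obtain y where y: "g = y +o range f" using assms(1) by (auto simp: cokernel_def)
  then obtain u where u: "x = y + f u" using assms(3) by (auto simp: elt_set_plus_def)
  obtain v where v: "\<alpha> = f v" using simple_in_range assms(2) by blast
  have "x - zsc n \<alpha> = y + f (u - zsc n v)"
    by (simp add: u v additive.diff[OF additive_f] additive_zsc[OF additive_f])
  then show ?thesis by (auto simp: y elt_set_plus_def)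
qed

lemma graded: "graded_algebra scale2 (cokernel f) (hecke_component f D2 scale2 \<theta>2 T2)"
proof -
  let ?A = "hecke_component f D2 scale2 \<theta>2 T2"
  let ?b = "\<lambda>(x, w). \<theta>2 x * T2 w" and ?I = "UNIV \<times> weyl D2"
  let ?B = "{\<theta>2 x * T2 w | x w. w \<in> weyl D2}"
  \<comment> \<open>The weight is read off a basis element; \<open>basis_distinct\<close> makes this
    independent of how the element is written.\<close>
  define deg where "deg b = fst (inv_into ?I ?b b) +o range f" for b
  have deg: "deg (\<theta>2 x * T2 w) = x +o range f" if "w \<in> weyl D2" for x w
    using inv_into_f_f[OF H2.basis_distinct, of "(x, w)"] that by (simp add: deg_def)
  then have "deg ` ?B \<subseteq> cokernel f" by (auto simp: cokernel_def)
  note decomposition =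
    H2.unique_decomposition_by_degree[OF H2.basis_independent H2.basis_span this]
  have "{b \<in> ?B. deg b = g} = {\<theta>2 x * T2 w | x w. x +o range f = g \<and> w \<in> weyl D2}" for g
    using deg by blast
  then have A: "?A g = H2.span {b \<in> ?B. deg b = g}" for g
    by (simp add: hecke_component_def)
  have "a * b \<in> ?A (g + g')"
    if g: "g \<in> cokernel f" "g' \<in> cokernel f" "a \<in> ?A g" "b \<in> ?A g'" for g g' a b
  proof -
    have "g + g' \<in> cokernel f" using g(1,2) coset_add by (auto simp: cokernel_def)
    then show ?thesis
      using H2.component_mult[of a g b g'] g cokernel_closed by (simp add: hecke_component_eq)
  qed
  then show ?thesis
    unfolding graded_algebra_def using decomposition A by auto
qed

section \<open>The image of the algebra homomorphism\<close>

lemma linear_hom: "Vector_Spaces.linear scale1 scale2 \<phi>"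
  using hom by (simp add: algebra_hom_def)

text \<open>\<open>hom_basis\<close> speaks only of identified pairs; every element of either Weyl
  group occurs in such a pair.\<close>

lemma hom_image_basis:
  "\<phi> ` {\<theta>1 x * T1 w | x w. w \<in> weyl D1} = {\<theta>2 (f x) * T2 w' | x w'. w' \<in> weyl D2}" (is "?L = ?R")
proof
  show "?L \<subseteq> ?R"
  proof
    fix b assume "b \<in> ?L"
    then obtain x w where b: "b = \<phi> (\<theta>1 x * T1 w)" "w \<in> weyl D1" by blast
    then obtain w' where "(w, w') \<in> weyl_identification D1 D2 f"
      using weyl_identification_left by blast
    then show "b \<in> ?R" using b hom_basis weyl_identification_weyl by blast
  qed
  show "?R \<subseteq> ?L"
  proof
    fix b assume "b \<in> ?R"
    then obtain x w' where b: "b = \<theta>2 (f x) * T2 w'" "w' \<in> weyl D2" by blast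
    then obtain w where w: "(w, w') \<in> weyl_identification D1 D2 f"
      using weyl_identification_right by blast
    then have "b = \<phi> (\<theta>1 x * T1 w)" using b hom_basis by simp
    then show "b \<in> ?L" using w weyl_identification_weyl by blast
  qed
qed

lemma component_zero: "hecke_component f D2 scale2 \<theta>2 T2 (range f) = range \<phi>"
proof -
  interpret module_hom scale1 scale2 \<phi>
    using linear_hom by (simp add: Vector_Spaces.linear_def)
  have "range f = 0 +o range f" by simp
  then have g: "range f \<in> cokernel f" unfolding cokernel_def by blast
  have "{\<theta>2 x * T2 w | x w. x \<in> range f \<and> w \<in> weyl D2} = {\<theta>2 (f x) * T2 w | x w. w \<in> weyl D2}"
    by blast
  then have "hecke_component f D2 scale2 \<theta>2 T2 (range f)
      = H2.span (\<phi> ` {\<theta>1 x * T1 w | x w. w \<in> weyl D1})"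
    by (simp add: hecke_component_eq[OF g] H2.component_def hom_image_basis)
  also have "\<dots> = range \<phi>" by (simp add: span_image H1.basis_span)
  finally show ?thesis .
qed

text \<open>The basis of the source is mapped injectively into the basis of the target, hence to an
  independent set.\<close>

lemma inj_hom:
  assumes "inj f"
  shows "inj \<phi>"
proof -
  let ?B = "{\<theta>1 x * T1 w | x w. w \<in> weyl D1}"
  interpret Vector_Spaces.linear scale1 scale2 \<phi> by (rule linear_hom)
  have "inj_on \<phi> ?B"
  proof (rule inj_onI)
    fix a b assume "a \<in> ?B" "b \<in> ?B" and eq: "\<phi> a = \<phi> b"
    then obtain x w y v where ab: "a = \<theta>1 x * T1 w" "w \<in> weyl D1" "b = \<theta>1 y * T1 v" "v \<in> weyl D1"
      by blast
    obtain w' v' where id: "(w, w') \<in> weyl_identification D1 D2 f"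
        "(v, v') \<in> weyl_identification D1 D2 f"
      using weyl_identification_left ab by blast
    have "\<theta>2 (f x) * T2 w' = \<theta>2 (f y) * T2 v'" using eq ab id hom_basis by simp
    then have xw: "f x = f y" "w' = v'"
      using inj_onD[OF H2.basis_distinct, of "(f x, w')" "(f y, v')"] id weyl_identification_weyl
      by auto
    \<comment> \<open>Equality of the images of \<open>w\<close> and \<open>v\<close> pulls back by
      equivariance and injectivity of \<open>f\<close>.\<close>
    have "f (w z) = f (v z)" for z
      using weyl_identification_equivariant[OF id(1)] weyl_identification_equivariant[OF id(2)] xw(2)
      by simp
    then have "w = v" using assms by (simp add: fun_eq_iff inj_eq)
    then show "a = b" using ab xw assms by (simp add: inj_eq)
  qed
  moreover have "H2.independent (\<phi> ` ?B)"
    unfolding hom_image_basis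
    by (rule H2.independent_mono[OF H2.basis_independent]) blast
  ultimately have "inj_on \<phi> (H1.span ?B)"
    using inj_on_span_iff_independent_image by blast
  then show ?thesis by (simp add: H1.basis_span)
qed

end

text \<open>As \<open>f\<close> may have a kernel, the degree zero part is compared with the image
  of \<open>\<phi>\<close>; the last conjunct identifies that image with the source algebra when
  \<open>f\<close> is injective.\<close>

theorem proposition4p7:
  fixes q :: real
    and D1 :: "('x1::ab_group_add, 'y1::ab_group_add) root_datum"
    and lam1 lams1 :: "'x1 \<Rightarrow> real"
    and scale1 :: "complex \<Rightarrow> 'h1::ring_1 \<Rightarrow> 'h1"
    and \<theta>1 :: "'x1 \<Rightarrow> 'h1"
    and T1 :: "('x1 \<Rightarrow> 'x1) \<Rightarrow> 'h1"
    and D2 :: "('x2::ab_group_add, 'y2::ab_group_add) root_datum"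
    and lam2 lams2 :: "'x2 \<Rightarrow> real"
    and scale2 :: "complex \<Rightarrow> 'h2::ring_1 \<Rightarrow> 'h2"
    and \<theta>2 :: "'x2 \<Rightarrow> 'h2"
    and T2 :: "('x2 \<Rightarrow> 'x2) \<Rightarrow> 'h2"
    and f :: "'x1 \<Rightarrow> 'x2"
    and \<phi> :: "'h1 \<Rightarrow> 'h2"
  assumes "central_hecke_morphism q D1 lam1 lams1 scale1 \<theta>1 T1 D2 lam2 lams2 scale2 \<theta>2 T2 f \<phi>"
  shows "graded_algebra scale2 (cokernel f) (hecke_component f D2 scale2 \<theta>2 T2)
    \<and> hecke_component f D2 scale2 \<theta>2 T2 (range f) = range \<phi>
    \<and> (inj f \<longrightarrow> inj \<phi>)"
proof -
  interpret central_hecke_morphism q D1 lam1 lams1 scale1 \<theta>1 T1 D2 lam2 lams2 scale2 \<theta>2 T2 f \<phi>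
    by (rule assms)
  show ?thesis using graded component_zero inj_hom by blast
qed

end
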